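(* Let $t\ge1$ be an integer and, for each $i\in\{1,\ldots,t\}$, let $\{A^i_n\}_{n=0}^\infty$ be a periodic sequence of positive real numbers with period $p_i\in\{1,2,\ldots\}$. Let $d=t/2$ if $t$ is even and let $d=(t-1)/2$ if $t$ is odd. If $t$ is odd, then assume also that for $i=(t+1)/2$ there is a positive integer $k_i$ such that $p_i=(t+1)k_i$ and, for some $j\in\{1,\ldots,t+1\}$ and for all $l_i\in\{1,\ldots,k_i\}$, $$A^i_{(t+1)l_i+(t+1)+j}<A^i_{(t+1)l_i+i+j}.$$ Then every positive solution $\{x_n\}_{n=-t}^\infty$ of $$x_n=\max\left\{\frac{A^1_{n-1}}{x_{n-1}},\frac{A^2_{n-1}}{x_{n-2}},\ldots,\frac{A^t_{n-1}}{x_{n-t}}\right\},\qquad n=1,2,\ldots,$$ is unbounded if either of the following holds: 1. For each $i\in\{1,\ldots,d\}$, we have (a) $p_i=(t+1)k_i$, where $k_i$ is a positive integer, and (b) for some $j\in\{1,\ldots,t+1\}$ and for all $l_i\in\{1,\ldots,k_i\}$, $$A^i_{(t+1)l_i+(t+1)+j}<\min\{A^{t+1-i}_1,\ldots,A^{t+1-i}_{p_{t+1-i}}\}<\max\{A^{t+1-i}_1,\ldots,A^{t+1-i}_{p_{t+1-i}}\}<A^i_{(t+1)l_i+i+j}.$$ 2. For each $i\in\{1,\ldots,d\}$, we have (a) $p_{t+1-i}=(t+1)k_{t+1-i}$, where $k_{t+1-i}$ is a positive integer, and (b) for some $j\in\{1,\ldots,t+1\}$ and for all $l_{t+1-i}\in\{1,\ldots,k_{t+1-i}\}$,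 $$A^{t+1-i}_{(t+1)l_{t+1-i}+(t+1)+j}<\min\{A^i_1,\ldots,A^i_{p_i}\}<\max\{A^i_1,\ldots,A^i_{p_i}\}<A^{t+1-i}_{(t+1)l_{t+1-i}+(t+1-i)+j}.$$
   Context: A positive solution is a sequence $\{x_n\}_{n=-t}^{\infty}$ of positive real numbers (with arbitrary positive initial values) satisfying the recurrence for every $n\ge 1$. A positive sequence is bounded if there is a constant $M>0$ with $0<x_n\le M$ for all $n\ge -t$, and unbounded otherwise.
   Formalization: The index j is taken to be one and the same for all i in condition 1 or 2 and, for odd t, also in the condition on i=(t+1)/2; if j may vary with i, as literally worded, the claim fails (bounded periodic solutions exist for t=3 and t=4). *)

theory Defs
  imports Complex_Main
begin

(* "Period" means a period, not necessarily the least one. *)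
definition periodic_with :: "nat \<Rightarrow> (nat \<Rightarrow> real) \<Rightarrow> bool" where
  "periodic_with p a \<longleftrightarrow> p \<ge> 1 \<and> (\<forall>n. a (n + p) = a n)"

(* A sequence indexed by n = -t, -t+1, ... is a function on int; its values at indices
   below -t are irrelevant. *)
definition positive_solution ::
    "nat \<Rightarrow> (nat \<Rightarrow> nat \<Rightarrow> real) \<Rightarrow> (int \<Rightarrow> real) \<Rightarrow> bool" where
  "positive_solution t A x \<longleftrightarrow>
     (\<forall>n\<ge>- int t. x n > 0) \<and>
     (\<forall>n\<ge>1. x n = Max ((\<lambda>i. A i (nat (n - 1)) / x (n - int i)) ` {1..t}))"

definition bounded_seq :: "nat \<Rightarrow> (int \<Rightarrow> real) \<Rightarrow> bool" where
  "bounded_seq t x \<longleftrightarrow> (\<exists>M>0. \<forall>n\<ge>- int t. 0 < x n \<and> x n \<le> M)"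

definition unbounded_seq :: "nat \<Rightarrow> (int \<Rightarrow> real) \<Rightarrow> bool" where
  "unbounded_seq t x \<longleftrightarrow> \<not> bounded_seq t x"

(* In the theorem the residue j is the same for all coefficient sequences, including the middle
   one when t is odd.  If j may depend on i, the claim fails.  For t = 4, take period 5 and, with
   (A i 0, ..., A i 4) listed for i = 1, 2, 3, 4,
     (2, 8, 1/2, 30, 6), (1/20, 6, 100, 9, 2), (27, 9, 2, 4, 6), (8, 8, 12, 2, 2).
   Then i = 1 satisfies its condition only for j = 2 and i = 2 only for j = 5, and a solution
   with x n in {20/9, 18/5, 45, 5/2, 12/5} for all n, of period 5, exists. *)

end

theory Submission
  imports Defs
begin

text \<open>
  Write \<open>T = t + 1\<close> and consider the indices \<open>N\<close> congruent to \<open>j\<close> modulo \<open>T\<close>.  The recurrence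
  says that \<open>x (N + 1) * x (N + 1 - i) \<ge> A i N\<close> for every \<open>i\<close>, with equality for at least one \<open>i\<close>.
  The shifts \<open>i\<close> and \<open>T - i\<close> are complementary: taking an \<open>i\<close> with equality at \<open>N\<close> and using the
  inequality for \<open>T - i\<close> at \<open>N - i\<close>, the common factor \<open>x (N + 1 - i)\<close> cancels and leaves
  \<open>x (N + 1) \<le> (A i N / A (T - i) (N - i)) * x (N + 1 - T)\<close>.

  Either alternative of the hypotheses, together with the one on the middle coefficient sequence
  for odd \<open>t\<close>, makes these ratios smaller than \<open>1\<close> for all \<open>i\<close>.  In each complementary pair, one
  sequence is separated from the range of the other: it lies below that range at the indices \<open>N\<close>,
  which settles its own ratio, and above it at the indices that occur in the denominator of the
  other ratio.  In the middle, \<open>i = T - i\<close>, and the sequence is compared with its own shift.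
  Periodic sequences have finite range, so only finitely many ratios occur and they are bounded by
  some \<open>r < 1\<close>.  Thus \<open>x\<close> decays geometrically along one residue class modulo \<open>T\<close>.  The product of
  a term with its successor is at least the minimum of the sequence \<open>A 1\<close>, which is positive,
  so the successors of the terms in that residue class grow without bound.
\<close>

lemma periodic_with_mult:
  assumes "periodic_with p a"
  shows "a (n + p * q) = a n"
proof (induction q)
  case (Suc q)
  have "a ((n + p * q) + p) = a (n + p * q)"
    using assms unfolding periodic_with_def by blast
  then show ?case using Suc by (simp add: algebra_simps)
qed simp

lemma periodic_with_mem_period:
  assumes "periodic_with p a"
  shows "a n \<in> a ` {1..p}"
proof -
  have p: "p \<ge> 1" using assms unfolding periodic_with_def by blast
  show ?thesis
  proof (cases "n mod p = 0")
    case True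
    then have "n + p * 1 = p + p * (n div p)" by auto
    then have "a n = a p"
      using periodic_with_mult[OF assms, of n 1] periodic_with_mult[OF assms, of p "n div p"]
      by (simp only:)
    then show ?thesis using p by auto
  next
    case False
    have "a n = a (n mod p)"
      using periodic_with_mult[OF assms, of "n mod p" "n div p"] by simp
    moreover have "n mod p \<in> {1..p}" using False p by (auto simp: less_imp_le)
    ultimately show ?thesis by blast
  qed
qed

lemma periodic_with_finite_range:
  assumes "periodic_with p a"
  shows "finite (range a)"
proof (rule finite_subset)
  show "range a \<subseteq> a ` {1..p}" using periodic_with_mem_period[OF assms] by blast
qed simp

lemma periodic_with_Min_le:
  assumes "periodic_with p a"
  shows "Min (a ` {1..p}) \<le> a n"
  using periodic_with_mem_period[OF assms] by (intro Min_le) auto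

lemma periodic_with_le_Max:
  assumes "periodic_with p a"
  shows "a n \<le> Max (a ` {1..p})"
  using periodic_with_mem_period[OF assms] by (intro Max_ge) auto

text \<open>A condition on the values of a \<open>T * k\<close>-periodic sequence in the blocks \<open>1, \<dots>, k\<close> of length
  \<open>T\<close> passes to every later block, each of which repeats one of these.\<close>

lemma block_representative:
  fixes l k :: nat
  assumes "periodic_with (T * k) a" and "l \<ge> 1"
  obtains m where "m \<in> {1..k}" and "\<And>c. a (T * l + c) = a (T * m + c)"
proof -
  have k: "k \<ge> 1" using assms(1) unfolding periodic_with_def by (cases k) auto
  define m where "m = (l - 1) mod k + 1"
  have "m \<in> {1..k}" using k unfolding m_def by (auto simp: Suc_le_eq)
  moreover have "a (T * l + c) = a (T * m + c)" for c
  proof -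
    have l: "l = m + k * ((l - 1) div k)"
      unfolding m_def using assms(2) by (simp add: add.commute)
    have "T * l + c = (T * m + c) + T * k * ((l - 1) div k)"
      by (subst l) (simp add: algebra_simps)
    then show ?thesis by (simp only: periodic_with_mult[OF assms(1)])
  qed
  ultimately show ?thesis using that by blast
qed

text \<open>If \<open>a\<close> takes values below and above the range of \<open>b\<close> at the right places, then each of the
  two sequences is, at indices congruent to \<open>j\<close>, smaller than the other one at the complementary
  shift.  Both alternatives of the theorem are instances, with \<open>a\<close> and \<open>b\<close> interchanged.\<close>

lemma separated_complementary_less:
  assumes a: "periodic_with (T * k) a" and b: "periodic_with q b"
    and sep: "\<forall>l\<in>{1..k}. a (T * l + T + j) < Min (b ` {1..q}) \<and>
                Min (b ` {1..q}) < Max (b ` {1..q}) \<and> Max (b ` {1..q}) < a (T * l + i + j)"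
    and l: "l \<ge> 1"
  shows "a (T * l + T + j) < b n" and "b n < a (T * l + i + j)"
proof -
  obtain m where m: "m \<in> {1..k}" "\<And>c. a (T * l + c) = a (T * m + c)"
    using block_representative[OF a l] by blast
  have "a (T * l + T + j) = a (T * m + T + j)" and "a (T * l + i + j) = a (T * m + i + j)"
    using m(2) by (simp_all only: add.assoc)
  then show "a (T * l + T + j) < b n" and "b n < a (T * l + i + j)"
    using sep[rule_format, OF m(1)] periodic_with_Min_le[OF b, of n] periodic_with_le_Max[OF b, of n]
    by linarith+
qed

lemma self_complementary_less:
  assumes a: "periodic_with (T * k) a"
    and less: "\<forall>l\<in>{1..k}. a (T * l + T + j) < a (T * l + i + j)"
    and l: "l \<ge> 1"
  shows "a (T * l + T + j) < a (T * l + i + j)"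
proof -
  obtain m where "m \<in> {1..k}" "\<And>c. a (T * l + c) = a (T * m + c)"
    using block_representative[OF a l] by blast
  then show ?thesis using less by (simp only: add.assoc)
qed

lemma positive_solution_pos:
  assumes "positive_solution t A x" and "n \<ge> - int t"
  shows "x n > 0"
  using assms unfolding positive_solution_def by blast

lemma positive_solution_product_ge:
  assumes "positive_solution t A x" and i: "i \<in> {1..t}"
  shows "A i N \<le> x (int N + 1) * x (int N + 1 - int i)"
proof -
  have "x (int N + 1) = Max ((\<lambda>i. A i N / x (int N + 1 - int i)) ` {1..t})"
    using assms(1) unfolding positive_solution_def by auto
  then have "A i N / x (int N + 1 - int i) \<le> x (int N + 1)"
    using i by auto
  moreover have "x (int N + 1 - int i) > 0"
    using i by (intro positive_solution_pos[OF assms(1)]) auto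
  ultimately show ?thesis by (simp add: pos_divide_le_eq)
qed

lemma positive_solution_product_attained:
  assumes "positive_solution t A x" and "t \<ge> 1"
  obtains i where "i \<in> {1..t}" and "x (int N + 1) * x (int N + 1 - int i) = A i N"
proof -
  let ?S = "(\<lambda>i. A i N / x (int N + 1 - int i)) ` {1..t}"
  have "x (int N + 1) = Max ?S"
    using assms(1) unfolding positive_solution_def by auto
  moreover have "Max ?S \<in> ?S" using assms(2) by (intro Max_in) auto
  ultimately obtain i where i: "i \<in> {1..t}" "x (int N + 1) = A i N / x (int N + 1 - int i)"
    by auto
  moreover have "x (int N + 1 - int i) > 0"
    using i(1) by (intro positive_solution_pos[OF assms(1)]) auto
  ultimately show ?thesis using that by simp
qed

text \<open>The cancellation step: \<open>N + 1 - T = (N - i) + 1 - (T - i)\<close>, so \<open>x (N + 1 - i)\<close> occurs both in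
  the product that is attained at \<open>N\<close> and in the one that is bounded below at \<open>N - i\<close>.\<close>

lemma positive_solution_contraction:
  assumes sol: "positive_solution t A x" and t: "t \<ge> 1" and N: "N \<ge> t"
    and ratio: "\<And>i. i \<in> {1..t} \<Longrightarrow> A i N \<le> r * A (t + 1 - i) (N - i)"
    and r: "r \<ge> 0"
  shows "x (int N + 1) \<le> r * x (int N - int t)"
proof -
  obtain i where i: "i \<in> {1..t}" and eq: "x (int N + 1) * x (int N + 1 - int i) = A i N"
    using positive_solution_product_attained[OF sol t] by blast
  have "t + 1 - i \<in> {1..t}" using i by auto
  note positive_solution_product_ge[OF sol this, of "N - i"]
  moreover have "int (N - i) + 1 = int N + 1 - int i"
    and "int N + 1 - int i - int (t + 1 - i) = int N - int t"
    using i N by (auto simp: of_nat_diff)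
  ultimately have ge: "A (t + 1 - i) (N - i) \<le> x (int N + 1 - int i) * x (int N - int t)"
    by (simp only:)
  have pos: "x (int N + 1 - int i) > 0"
    using i by (intro positive_solution_pos[OF sol]) auto
  have "x (int N + 1) * x (int N + 1 - int i) \<le> r * A (t + 1 - i) (N - i)"
    using ratio[OF i] eq by simp
  also have "\<dots> \<le> r * (x (int N + 1 - int i) * x (int N - int t))"
    using ge r by (rule mult_left_mono)
  finally have "x (int N + 1) * x (int N + 1 - int i)
      \<le> (r * x (int N - int t)) * x (int N + 1 - int i)"
    by (simp add: mult_ac)
  then show ?thesis using pos by simp
qed

text \<open>Finiteness of the ranges makes the strict inequalities between complementary coefficients
  uniform.\<close>

lemma uniform_ratio:
  fixes A B :: "nat \<Rightarrow> nat \<Rightarrow> real"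
  assumes "finite I"
    and "\<And>i. i \<in> I \<Longrightarrow> finite (range (A i)) \<and> finite (range (B i))"
    and "\<And>i n. i \<in> I \<Longrightarrow> B i n > 0"
  obtains r where "0 \<le> r" and "r < 1"
    and "\<And>i m n. i \<in> I \<Longrightarrow> A i m < B i n \<Longrightarrow> A i m \<le> r * B i n"
proof -
  define S where "S = (\<Union>i\<in>I. (\<lambda>(u, v). u / v) ` (range (A i) \<times> range (B i))) \<inter> {..<1}"
  have fin: "finite S"
    unfolding S_def
  proof (intro finite_Int disjI1 finite_UN_I[OF assms(1)])
    show "finite ((\<lambda>(u, v). u / v) ` (range (A i) \<times> range (B i)))" if "i \<in> I" for i
      using assms(2)[OF that] by (blast intro: finite_cartesian_product)
  qed
  (* 0 is inserted so that the maximum exists and is nonnegative. *)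
  define r where "r = Max (insert 0 S)"
  have "r \<in> insert 0 S" unfolding r_def using fin by (intro Max_in) auto
  then have "r < 1" unfolding S_def by auto
  moreover have "0 \<le> r" unfolding r_def using fin by (intro Max_ge) auto
  moreover have "A i m \<le> r * B i n" if i: "i \<in> I" and less: "A i m < B i n" for i m n
  proof -
    have pos: "B i n > 0" using assms(3) i by blast
    have "A i m / B i n < 1" using less pos by simp
    then have "A i m / B i n \<in> S" unfolding S_def using i by force
    then have "A i m / B i n \<le> r" unfolding r_def using fin by (intro Max_ge) auto
    then show ?thesis using pos by (simp add: pos_divide_le_eq)
  qed
  ultimately show ?thesis using that by blast
qed

text \<open>The two indices in the hypothesis \<open>less\<close> are \<open>N\<close> and \<open>N - i\<close> for \<open>N = T * l + T + j\<close> with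
  \<open>T = t + 1\<close>, as the contraction requires.\<close>

lemma unbounded_if_complementary_less:
  assumes t: "t \<ge> 1"
    and A: "\<And>i. i \<in> {1..t} \<Longrightarrow> (\<forall>n. A i n > 0) \<and> periodic_with (p i) (A i)"
    and less: "\<And>i l. i \<in> {1..t} \<Longrightarrow> l \<ge> 1 \<Longrightarrow>
      A i ((t + 1) * l + (t + 1) + j) < A (t + 1 - i) ((t + 1) * l + (t + 1 - i) + j)"
    and sol: "positive_solution t A x"
  shows "unbounded_seq t x"
  unfolding unbounded_seq_def
proof
  assume "bounded_seq t x"
  then obtain M where M: "M > 0" "\<And>n. n \<ge> - int t \<Longrightarrow> x n \<le> M"
    unfolding bounded_seq_def by blast
  obtain r where r: "0 \<le> r" "r < 1"
    and ratio: "\<And>i m n. i \<in> {1..t} \<Longrightarrow> A i m < A (t + 1 - i) n \<Longrightarrow> A i m \<le> r * A (t + 1 - i) n"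
  proof (rule uniform_ratio[of "{1..t}" A "\<lambda>i. A (t + 1 - i)"])
    have fin: "finite (range (A i))" if "i \<in> {1..t}" for i
      using A[OF that] periodic_with_finite_range by blast
    show "finite (range (A i)) \<and> finite (range (A (t + 1 - i)))" if "i \<in> {1..t}" for i
      using that by (intro conjI fin) auto
    show "A (t + 1 - i) n > 0" if "i \<in> {1..t}" for i n
      using that by (intro A[THEN conjunct1, rule_format]) auto
  qed auto
  define N where "N l = (t + 1) * (l + 1) + j" for l
  define y where "y l = x (int (N l) + 1)" for l
  have step: "y (Suc l) \<le> r * y l" for l
  proof -
    have "x (int (N (Suc l)) + 1) \<le> r * x (int (N (Suc l)) - int t)"
    proof (rule positive_solution_contraction[OF sol t _ _ r(1)])
      show "N (Suc l) \<ge> t" unfolding N_def by simp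
      fix i assume i: "i \<in> {1..t}"
      have "N (Suc l) = (t + 1) * (l + 1) + (t + 1) + j"
        and "N (Suc l) - i = (t + 1) * (l + 1) + (t + 1 - i) + j"
        using i unfolding N_def by (auto simp: algebra_simps)
      then have "A i (N (Suc l)) < A (t + 1 - i) (N (Suc l) - i)"
        using less[OF i, of "l + 1"] by simp
      then show "A i (N (Suc l)) \<le> r * A (t + 1 - i) (N (Suc l) - i)"
        by (rule ratio[OF i])
    qed
    moreover have "int (N (Suc l)) - int t = int (N l) + 1"
      unfolding N_def by (simp add: algebra_simps)
    ultimately show ?thesis unfolding y_def by simp
  qed
  have decay: "y l \<le> r ^ l * M" for l
  proof (induction l)
    case 0
    then show ?case unfolding y_def using M(2) by simp
  next
    case (Suc l)
    then have "r * y l \<le> r * (r ^ l * M)" using r(1) by (intro mult_left_mono)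
    then show ?case using step[of l] by (simp add: mult.assoc)
  qed
  define c where "c = Min (range (A 1))"
  have fin: "finite (range (A 1))" using A[of 1] t periodic_with_finite_range by auto
  have "c \<in> range (A 1)" unfolding c_def using fin by (intro Min_in) auto
  then have c: "c > 0" using A[of 1] t by auto
  have low: "c \<le> r ^ l * (M * M)" for l
  proof -
    have "c \<le> A 1 (N l + 1)" unfolding c_def using fin by (intro Min_le) auto
    also have "\<dots> \<le> x (int (N l) + 2) * y l"
      using positive_solution_product_ge[OF sol, of 1 "N l + 1"] t
      unfolding y_def by (simp add: add.commute)
    also have "\<dots> \<le> M * y l"
      using M(2)[of "int (N l) + 2"] positive_solution_pos[OF sol, of "int (N l) + 1"]
      unfolding y_def by (intro mult_right_mono) auto
    also have "\<dots> \<le> M * (r ^ l * M)" using decay[of l] M(1) by (intro mult_left_mono) auto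
    finally show ?thesis by (simp add: mult_ac)
  qed
  have "(\<lambda>l. r ^ l * (M * M)) \<longlonglongrightarrow> 0"
    using LIMSEQ_realpow_zero[OF r] by (rule tendsto_mult_left_zero)
  then have "c \<le> 0" using low by (intro LIMSEQ_le_const) auto
  then show False using c by simp
qed

theorem corollary11:
  fixes t d j :: nat
    and p :: "nat \<Rightarrow> nat"
    and A :: "nat \<Rightarrow> nat \<Rightarrow> real"
  assumes "t \<ge> 1"
    and "\<forall>i\<in>{1..t}. (\<forall>n. A i n > 0) \<and> periodic_with (p i) (A i)"
    and "d = (if even t then t div 2 else (t - 1) div 2)"
    and "j \<in> {1..t + 1}"
    and "odd t \<longrightarrow> (\<forall>i. i = (t + 1) div 2 \<longrightarrow>
           (\<exists>k\<ge>1. p i = (t + 1) * k \<and>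
             (\<forall>l\<in>{1..k}. A i ((t + 1) * l + (t + 1) + j) < A i ((t + 1) * l + i + j))))"
    and "(\<forall>i\<in>{1..d}. \<exists>k\<ge>1. p i = (t + 1) * k \<and>
            (\<forall>l\<in>{1..k}.
               A i ((t + 1) * l + (t + 1) + j) < Min (A (t + 1 - i) ` {1..p (t + 1 - i)}) \<and>
               Min (A (t + 1 - i) ` {1..p (t + 1 - i)}) < Max (A (t + 1 - i) ` {1..p (t + 1 - i)}) \<and>
               Max (A (t + 1 - i) ` {1..p (t + 1 - i)}) < A i ((t + 1) * l + i + j)))
       \<or> (\<forall>i\<in>{1..d}. \<exists>k\<ge>1. p (t + 1 - i) = (t + 1) * k \<and>
            (\<forall>l\<in>{1..k}.
               A (t + 1 - i) ((t + 1) * l + (t + 1) + j) < Min (A i ` {1..p i}) \<and>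
               Min (A i ` {1..p i}) < Max (A i ` {1..p i}) \<and>
               Max (A i ` {1..p i}) < A (t + 1 - i) ((t + 1) * l + (t + 1 - i) + j)))"
  shows "\<forall>x. positive_solution t A x \<longrightarrow> unbounded_seq t x"
proof (intro allI impI)
  fix x
  assume "positive_solution t A x"
  have per: "periodic_with (p i) (A i)" if "i \<in> {1..t}" for i
    using assms(2) that by blast
  (* Whichever member of a complementary pair is the separated one, the comparison holds for both. *)
  have pair: "A i ((t + 1) * l + (t + 1) + j) < A (t + 1 - i) ((t + 1) * l + (t + 1 - i) + j) \<and>
      A (t + 1 - i) ((t + 1) * l + (t + 1) + j) < A i ((t + 1) * l + i + j)"
    if i: "i \<in> {1..d}" and l: "l \<ge> 1" for i l
  proof -
    have mem: "i \<in> {1..t}" "t + 1 - i \<in> {1..t}"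
      using i assms(3) by (auto split: if_splits)
    show ?thesis
      using assms(6)
    proof
      assume "\<forall>i\<in>{1..d}. \<exists>k\<ge>1. p i = (t + 1) * k \<and>
            (\<forall>l\<in>{1..k}.
               A i ((t + 1) * l + (t + 1) + j) < Min (A (t + 1 - i) ` {1..p (t + 1 - i)}) \<and>
               Min (A (t + 1 - i) ` {1..p (t + 1 - i)}) < Max (A (t + 1 - i) ` {1..p (t + 1 - i)}) \<and>
               Max (A (t + 1 - i) ` {1..p (t + 1 - i)}) < A i ((t + 1) * l + i + j))"
      then obtain k where "p i = (t + 1) * k" and sep: "\<forall>l\<in>{1..k}.
               A i ((t + 1) * l + (t + 1) + j) < Min (A (t + 1 - i) ` {1..p (t + 1 - i)}) \<and>
               Min (A (t + 1 - i) ` {1..p (t + 1 - i)}) < Max (A (t + 1 - i) ` {1..p (t + 1 - i)}) \<and>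
               Max (A (t + 1 - i) ` {1..p (t + 1 - i)}) < A i ((t + 1) * l + i + j)"
        using i by blast
      then have "periodic_with ((t + 1) * k) (A i)" using per[OF mem(1)] by simp
      from separated_complementary_less[OF this per[OF mem(2)] sep l]
      show ?thesis by blast
    next
      assume "\<forall>i\<in>{1..d}. \<exists>k\<ge>1. p (t + 1 - i) = (t + 1) * k \<and>
            (\<forall>l\<in>{1..k}.
               A (t + 1 - i) ((t + 1) * l + (t + 1) + j) < Min (A i ` {1..p i}) \<and>
               Min (A i ` {1..p i}) < Max (A i ` {1..p i}) \<and>
               Max (A i ` {1..p i}) < A (t + 1 - i) ((t + 1) * l + (t + 1 - i) + j))"
      then obtain k where "p (t + 1 - i) = (t + 1) * k" and sep: "\<forall>l\<in>{1..k}.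
               A (t + 1 - i) ((t + 1) * l + (t + 1) + j) < Min (A i ` {1..p i}) \<and>
               Min (A i ` {1..p i}) < Max (A i ` {1..p i}) \<and>
               Max (A i ` {1..p i}) < A (t + 1 - i) ((t + 1) * l + (t + 1 - i) + j)"
        using i by blast
      then have "periodic_with ((t + 1) * k) (A (t + 1 - i))" using per[OF mem(2)] by simp
      from separated_complementary_less[OF this per[OF mem(1)] sep l]
      show ?thesis by blast
    qed
  qed
  show "unbounded_seq t x"
  proof (rule unbounded_if_complementary_less[OF assms(1) _ _ \<open>positive_solution t A x\<close>])
    show "(\<forall>n. A i n > 0) \<and> periodic_with (p i) (A i)" if "i \<in> {1..t}" for i
      using assms(2) that by blast
    show "A i ((t + 1) * l + (t + 1) + j) < A (t + 1 - i) ((t + 1) * l + (t + 1 - i) + j)"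
      if i: "i \<in> {1..t}" and l: "l \<ge> 1" for i l
    proof -
      consider "i \<in> {1..d}" | "t + 1 - i \<in> {1..d}" | "odd t" "i = (t + 1) div 2" "t + 1 - i = i"
        using i assms(3) by (cases "even t") (auto elim!: evenE oddE, linarith+)
      then show ?thesis
      proof cases
        case 1
        then show ?thesis using pair l by blast
      next
        case 2
        moreover have "t + 1 - (t + 1 - i) = i" using i by auto
        ultimately show ?thesis using pair[OF 2 l] by simp
      next
        case 3
        then obtain k where "p i = (t + 1) * k"
          and mid: "\<forall>l\<in>{1..k}. A i ((t + 1) * l + (t + 1) + j) < A i ((t + 1) * l + i + j)"
          using assms(5) by blast
        then have "periodic_with ((t + 1) * k) (A i)" using per[OF i] by simp
        from self_complementary_less[OF this mid l] show ?thesis using 3(3) by simp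
      qed
    qed
  qed
qed

end
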